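(* Let $(E,\|\cdot\|)$ be a Banach space. Then the class $\mathcal{C}_{B}(E)$ of all Banach contractions $T:E\to E$ is an unsaturated class of mappings, i.e. the inclusion $\mathcal{C}_{B}(E)\subset \mathcal{C}_{B}^{e}(E)$ is strict.
   Context: For a self mapping $T:X\to X$ of a linear normed space $(X,\|\cdot\|)$ and $\lambda\in(0,1]$, the averaged mapping $T_\lambda:X\to X$ is $T_\lambda x=(1-\lambda)x+\lambda Tx$. If $\mathcal{C}$ is a subset of the family of all self mappings of $X$, a mapping $T:X\to X$ is called $\mathcal{C}$-enriched if there exists $\lambda\in(0,1]$ such that $T_\lambda\in\mathcal{C}$; $\mathcal{C}^{e}$ denotes the set of all $\mathcal{C}$-enriched mappings. One always has $\mathcal{C}\subseteq\mathcal{C}^{e}$ (take $\lambda=1$). The class $\mathcal{C}$ is called unsaturated if the inclusion $\mathcal{C}\subset\mathcal{C}^{e}$ is strict, and saturated if $\mathcal{C}=\mathcal{C}^{e}$. A mapping $T:X\to X$ is a Banach contraction if there exists a constant $c\in[0,1)$ such that $\|Tx-Ty\|\le c\,\|x-y\|$ for all $x,y\in X$. $\mathcal{C}_{B}(X)$ denotes the class of all Banach contractions on $X$, and $\mathcal{C}_{B}^{e}(X)=(\mathcal{C}_{B}(X))^{e}$.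
   Formalization: The Banach space E is assumed to be nonzero; for E = {0} the only self-mapping is a Banach contraction, so the inclusion is an equality and the claim fails. *)

theory Defs
  imports "HOL-Analysis.Analysis"
begin

definition averaged :: "real \<Rightarrow> ('a::real_normed_vector \<Rightarrow> 'a) \<Rightarrow> 'a \<Rightarrow> 'a" where
  "averaged l T = (\<lambda>x. (1 - l) *\<^sub>R x + l *\<^sub>R T x)"

definition enriched :: "('a::real_normed_vector \<Rightarrow> 'a) set \<Rightarrow> ('a \<Rightarrow> 'a) set" where
  "enriched C = {T. \<exists>l\<in>{0<..1}. averaged l T \<in> C}"

definition unsaturated :: "('a::real_normed_vector \<Rightarrow> 'a) set \<Rightarrow> bool" where
  "unsaturated C \<longleftrightarrow> C \<subset> enriched C"

definition banach_contractions :: "('a::real_normed_vector \<Rightarrow> 'a) set" where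
  "banach_contractions = {T. \<exists>c\<in>{0..<1}. \<forall>x y. norm (T x - T y) \<le> c * norm (x - y)}"

end

theory Submission
  imports Defs
begin

text \<open>The witness for strictness is the reflection \<open>uminus\<close>. It is an isometry,
  so on a nonzero space no constant below 1 works for it, yet averaging it with the identity at
  equal weights gives the zero map, a contraction. On the zero space the only self map is a
  contraction, so strictness would fail there; hence the assumption of a nonzero vector.\<close>

lemma subset_enriched: "C \<subseteq> enriched C"
proof
  fix T assume "T \<in> C"
  moreover have "averaged 1 T = T"
    by (simp add: averaged_def)
  ultimately show "T \<in> enriched C"
    unfolding enriched_def by (auto intro!: bexI[of _ 1])
qed

text \<open>Negation preserves distances, so comparing any nonzero vector with 0 forces a
  contraction constant of at least 1.\<close>

lemma uminus_notin_banach_contractions: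
  assumes "\<exists>x::'a::real_normed_vector. x \<noteq> 0"
  shows "(uminus :: 'a \<Rightarrow> 'a) \<notin> banach_contractions"
proof
  assume "(uminus :: 'a \<Rightarrow> 'a) \<in> banach_contractions"
  then obtain c :: real where c: "c < 1"
    and contr: "\<And>x y::'a. norm (- x - - y) \<le> c * norm (x - y)"
    unfolding banach_contractions_def by auto
  obtain x :: 'a where "x \<noteq> 0" using assms by blast
  moreover have "norm x \<le> c * norm x"
    using contr[of x 0] by simp
  ultimately show False using c by simp
qed

lemma uminus_in_enriched_banach_contractions:
  "(uminus :: 'a::real_normed_vector \<Rightarrow> 'a) \<in> enriched banach_contractions"
proof -
  \<comment> \<open>The average is \<open>(1 - 2 * l)\<close> times the identity;
    \<open>l = 1/2\<close> makes it constant, so that \<open>c = 0\<close> suffices.\<close>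
  have "averaged (1/2) (uminus :: 'a \<Rightarrow> 'a) = (\<lambda>x. 0)"
    by (simp add: averaged_def)
  moreover have "(\<lambda>x::'a. 0) \<in> banach_contractions"
    unfolding banach_contractions_def by (auto intro!: bexI[of _ 0])
  ultimately show ?thesis
    unfolding enriched_def by (auto intro!: bexI[of _ "1/2"])
qed

theorem proposition3:
  assumes "\<exists>x::'a::banach. x \<noteq> 0"
  shows "unsaturated (banach_contractions :: ('a \<Rightarrow> 'a) set)"
  unfolding unsaturated_def
  using subset_enriched uminus_in_enriched_banach_contractions
    uminus_notin_banach_contractions[OF assms]
  by blast

end
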